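(* Let $n,N\ge 1$ be integers, let $S=\{r=(r_1,\dots,r_n)\in\mathbb{Z}^n : -N\le r_i\le N \text{ for } 1\le i\le n\}$ and $L=(2N+1)^n$, and let $(\overline{a^N},\lambda_N)$ be the optimizer on $S$, i.e. $\overline{a^N}=(\overline{a^N_r})_{r\in S}\in\overline{\mathbb{R}_+^L}$, $\|\overline{a^N}\|_2=1$, and $$\sum_{r,s\in S,\ r\ne s}\frac{\overline{a^N_r}\,\overline{a^N_s}}{|r-s|^n}=\lambda_N .$$ Then $\overline{a^N}\in\mathbb{R}_+^L$, and $\overline{a^N}$ is monotonically decaying from its central element: for every $1\le i\le n$, $$\overline{a^N_{(r_i,r')}}\le \overline{a^N_{(r_i-1,r')}}\quad\text{for } 1\le r_i\le N,$$ $$\overline{a^N_{(r_i,r')}}\ge \overline{a^N_{(r_i-1,r')}}\quad\text{for } -N+1\le r_i\le 0,$$ for every choice of the remaining coordinates $r'\in\{-N,\dots,N\}^{n-1}$.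
   Context: $|\cdot|$ on $\mathbb{R}^n$ is the Euclidean norm; $\|a\|_2=(\sum_{r\in S} a_r^2)^{1/2}$. Vectors in $\mathbb{R}^L$ are indexed by the points of $S$; $\mathbb{R}_+^L$ is the set of vectors with all entries strictly positive, $\overline{\mathbb{R}_+^L}$ the set of vectors with all entries nonnegative. The constant $\lambda_N$ is here $$\lambda_N=\max_{\|a\|_2=\|b\|_2=1}\ \sum_{r,s\in S,\ r\neq s}\frac{a_r b_s}{|r-s|^n},$$ the maximum being over $a,b\in\mathbb{R}^L$. For fixed $i$, $(r_i,r')$ denotes the point of $S$ whose $i$-th coordinate is $r_i$ and whose remaining $n-1$ coordinates are given by $r'$. *)

theory Defs
  imports "HOL-Analysis.Analysis"
begin

definition int_cube :: "nat \<Rightarrow> (int ^ 'n) set" where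
  "int_cube N = {r. \<forall>i. - int N \<le> r $ i \<and> r $ i \<le> int N}"

definition enorm :: "int ^ 'n \<Rightarrow> real" where
  "enorm x = norm (\<chi> i. real_of_int (x $ i))"

text \<open>
  A vector indexed by the points of a finite set \<open>S\<close> is a function on \<open>int ^ 'n\<close>
  of which only the values on \<open>S\<close> are used; its Euclidean norm is \<open>L2_set a S\<close>.
\<close>

definition hls_form :: "(int ^ 'n) set \<Rightarrow> (int ^ 'n \<Rightarrow> real) \<Rightarrow> (int ^ 'n \<Rightarrow> real) \<Rightarrow> real" where
  "hls_form S a b = (\<Sum>r\<in>S. \<Sum>s\<in>S - {r}. a r * b s / enorm (r - s) ^ CARD('n))"

text \<open>
  The maximum is taken literally, with \<open>GREATEST\<close>; \<open>Max\<close> is only meaningful for finite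
  sets of values. That it is attained is shown in \<open>hls_max_attained\<close> below.
\<close>

definition hls_max :: "(int ^ 'n) set \<Rightarrow> real" where
  "hls_max S = (GREATEST v. \<exists>a b. L2_set a S = 1 \<and> L2_set b S = 1 \<and> v = hls_form S a b)"

definition set_coord :: "'a ^ 'n \<Rightarrow> 'n \<Rightarrow> 'a \<Rightarrow> 'a ^ 'n" where
  "set_coord r i k = (\<chi> j. if j = i then k else r $ j)"

lemma hls_max_attained:
  fixes S :: "(int ^ 'n) set"
  assumes "finite S" "S \<noteq> {}"
  shows "\<exists>a b. L2_set a S = 1 \<and> L2_set b S = 1 \<and> hls_max S = hls_form S a b"
    and "\<And>a b. L2_set a S = 1 \<Longrightarrow> L2_set b S = 1 \<Longrightarrow> hls_form S a b \<le> hls_max S"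
proof -
  define P :: "(int ^ 'n \<Rightarrow> real) set" where
    "P = PiE UNIV (\<lambda>r. if r \<in> S then {-1..1} else {0})"
  define K where "K = P \<inter> {a. (\<Sum>r\<in>S. (a r)\<^sup>2) = 1}"
  have P: "compact P"
  proof -
    have "compactin (product_topology (\<lambda>r. euclidean) UNIV) P"
      unfolding P_def compactin_PiE by auto
    then show ?thesis by (simp add: euclidean_product_topology)
  qed
  have "closed {a :: int ^ 'n \<Rightarrow> real. (\<Sum>r\<in>S. (a r)\<^sup>2) = 1}"
    by (intro closed_Collect_eq continuous_intros) auto
  then have K: "compact K"
    unfolding K_def using P by (rule compact_Int_closed[rotated])
  have KK: "compact (K \<times> K)" using K K by (rule compact_Times)
  have norm1: "L2_set a S = 1 \<longleftrightarrow> (\<Sum>r\<in>S. (a r)\<^sup>2) = 1" for a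
    unfolding L2_set_def by simp
  have restr: "\<exists>a'\<in>K. \<forall>r\<in>S. a' r = a r" if "L2_set a S = 1" for a
  proof (rule bexI)
    let ?a = "\<lambda>r. if r \<in> S then a r else 0"
    show "\<forall>r\<in>S. ?a r = a r" by simp
    have "\<bar>a r\<bar> \<le> 1" if "r \<in> S" for r
    proof -
      have "\<bar>a r\<bar> \<le> L2_set (\<lambda>r. \<bar>a r\<bar>) S"
        using that assms(1) by (intro member_le_L2_set)
      also have "\<dots> = 1" using \<open>L2_set a S = 1\<close> by (simp add: L2_set_def)
      finally show ?thesis .
    qed
    then have "?a \<in> P" by (auto simp: P_def abs_le_iff)
    moreover have "(\<Sum>r\<in>S. (?a r)\<^sup>2) = 1"
      using that by (simp add: norm1)
    ultimately show "?a \<in> K" by (simp add: K_def)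
  qed
  obtain s where s: "s \<in> S" using assms(2) by blast
  have "L2_set (\<lambda>r. if r = s then 1 else 0) S = 1"
    using s assms(1) by (simp add: norm1 if_distrib[of "\<lambda>x. x\<^sup>2"] cong: if_cong)
  from restr[OF this] have ne: "K \<times> K \<noteq> {}" by blast
  have "continuous_on UNIV (\<lambda>p :: (int ^ 'n \<Rightarrow> real) \<times> (int ^ 'n \<Rightarrow> real). hls_form S (fst p) (snd p))"
    unfolding hls_form_def divide_inverse
    by (intro continuous_intros continuous_on_product_then_coordinatewise)
  then have "continuous_on (K \<times> K) (\<lambda>p. hls_form S (fst p) (snd p))"
    by (rule continuous_on_subset) simp
  from continuous_attains_sup[OF KK ne this] obtain a b where
    ab: "a \<in> K" "b \<in> K" and mx: "\<And>c d. c \<in> K \<Longrightarrow> d \<in> K \<Longrightarrow> hls_form S c d \<le> hls_form S a b"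
    by auto
  have mx': "hls_form S c d \<le> hls_form S a b" if cd1: "L2_set c S = 1" "L2_set d S = 1" for c d
  proof -
    obtain c' d' where cd: "c' \<in> K" "\<forall>r\<in>S. c' r = c r" "d' \<in> K" "\<forall>r\<in>S. d' r = d r"
      using restr[OF cd1(1)] restr[OF cd1(2)] by blast
    then have "hls_form S c d = hls_form S c' d'"
      unfolding hls_form_def by (intro sum.cong) auto
    then show ?thesis using mx cd by simp
  qed
  have n1: "L2_set a S = 1" "L2_set b S = 1"
    using ab by (auto simp: K_def norm1)
  have "hls_max S = hls_form S a b"
    unfolding hls_max_def by (rule Greatest_equality) (use n1 mx' in auto)
  then show "\<exists>a b. L2_set a S = 1 \<and> L2_set b S = 1 \<and> hls_max S = hls_form S a b"
    and "\<And>c d. L2_set c S = 1 \<Longrightarrow> L2_set d S = 1 \<Longrightarrow> hls_form S c d \<le> hls_max S"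
    using n1 mx' by auto
qed

end

theory Submission
  imports Defs
begin

text \<open>
  Positivity is a first variation argument: moving mass into an entry that vanishes raises
  the form to first order but the norm only to second order.

  Monotonicity is a polarization (two-point rearrangement) argument. Extend the optimizer by
  zero and reflect the \<open>i\<close>-th coordinate in the half-integer \<open>m / 2\<close>, with \<open>m\<close> odd. On every pair
  of mirror points, move the larger value to the point nearer to the origin. This keeps the support in
  the cube and preserves the norm, and it does not decrease the form, since the kernel is larger between
  points on the same side. The points of the cube whose mirror image
  leaves the cube carry positive values, so they are ordered strictly; against them any single pair in
  the wrong order would make the increase of the form strict.
\<close>

section \<open>Polarization with respect to an abstract involution\<close>

definition polarize :: "'a set \<Rightarrow> ('a \<Rightarrow> 'a) \<Rightarrow> ('a \<Rightarrow> real) \<Rightarrow> 'a \<Rightarrow> real" where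
  "polarize H \<sigma> u x = (if x \<in> H then max (u x) (u (\<sigma> x)) else min (u x) (u (\<sigma> x)))"

lemma sum_mirror:
  assumes "finite H" "inj_on \<sigma> H" "H \<inter> \<sigma> ` H = {}"
  shows "sum f (H \<union> \<sigma> ` H) = (\<Sum>x\<in>H. f x + f (\<sigma> x))"
  using assms by (simp add: sum.union_disjoint sum.reindex sum.distrib)

text \<open>For oppositely ordered pairs the right side exceeds the left by
  \<open>(p' - p) * (q - q')\<close>; for pairs ordered alike the two sides agree.\<close>

lemma max_min_rearrangement:
  fixes p p' q q' :: real
  shows "p * q + p' * q' \<le> max p p' * max q q' + min p p' * min q q'"
    and "p < p' \<Longrightarrow> q' < q \<Longrightarrow> p * q + p' * q' < max p p' * max q q' + min p p' * min q q'"
proof -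
  have *: "p * q + p' * q' \<le> p * q' + p' * q" if "p \<le> p'" "q' \<le> q"
    using mult_nonneg_nonneg[of "p' - p" "q - q'"] that by (simp add: algebra_simps)
  have **: "p * q + p' * q' \<le> p * q' + p' * q" if "p' \<le> p" "q \<le> q'"
    using mult_nonneg_nonneg[of "p - p'" "q' - q"] that by (simp add: algebra_simps)
  show "p * q + p' * q' \<le> max p p' * max q q' + min p p' * min q q'"
    using * ** by (auto simp: max_def min_def algebra_simps)
  assume "p < p'" "q' < q"
  then show "p * q + p' * q' < max p p' * max q q' + min p p' * min q q'"
    using mult_pos_pos[of "p' - p" "q - q'"] by (simp add: max_def min_def algebra_simps)
qed

context
  fixes H :: "'a set" and \<sigma> :: "'a \<Rightarrow> 'a"
  assumes fin: "finite H" and invol: "\<And>x. \<sigma> (\<sigma> x) = x" and disj: "H \<inter> \<sigma> ` H = {}"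
begin

lemma inj_mirror: "inj_on \<sigma> H"
  by (metis inj_onI invol)

lemma polarize_near: "x \<in> H \<Longrightarrow> polarize H \<sigma> u x = max (u x) (u (\<sigma> x))"
  and polarize_far: "x \<in> H \<Longrightarrow> polarize H \<sigma> u (\<sigma> x) = min (u x) (u (\<sigma> x))"
  using disj by (auto simp: polarize_def invol min.commute)

text \<open>Each mirror pair keeps its two values, possibly swapped. Taking \<open>f\<close> to be
  the square shows that the norm is preserved.\<close>

lemma sum_polarize:
  "(\<Sum>x\<in>H \<union> \<sigma> ` H. f (polarize H \<sigma> u x)) = (\<Sum>x\<in>H \<union> \<sigma> ` H. f (u x))"
  unfolding sum_mirror[OF fin inj_mirror disj]
  by (intro sum.cong) (auto simp: polarize_near polarize_far max_def min_def add.commute)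

text \<open>Grouping the four terms of two mirror pairs shows that no group decreases. The group of
  \<open>x\<close> and \<open>y\<close>, whose pairs are strictly ordered in opposite ways,
  increases strictly.\<close>

lemma polarize_less:
  fixes K :: "'a \<Rightarrow> 'a \<Rightarrow> real"
  assumes K1: "\<And>x y. K (\<sigma> x) (\<sigma> y) = K x y" and K2: "\<And>x y. K (\<sigma> x) y = K x (\<sigma> y)"
    and gt: "\<And>x y. x \<in> H \<Longrightarrow> y \<in> H \<Longrightarrow> x \<noteq> y \<Longrightarrow> K x (\<sigma> y) < K x y"
    and x: "x \<in> H" "u x < u (\<sigma> x)" and y: "y \<in> H" "u (\<sigma> y) < u y"
  shows "(\<Sum>r\<in>H \<union> \<sigma> ` H. \<Sum>s\<in>H \<union> \<sigma> ` H. u r * u s * K r s)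
    < (\<Sum>r\<in>H \<union> \<sigma> ` H. \<Sum>s\<in>H \<union> \<sigma> ` H. polarize H \<sigma> u r * polarize H \<sigma> u s * K r s)"
proof -
  define P where "P = polarize H \<sigma> u"
  define Q where "Q = (\<lambda>(v :: 'a \<Rightarrow> real) r s.
    (v r * v s + v (\<sigma> r) * v (\<sigma> s)) * K r s + (v r * v (\<sigma> s) + v (\<sigma> r) * v s) * K r (\<sigma> s))"
  have form: "(\<Sum>r\<in>H \<union> \<sigma> ` H. \<Sum>s\<in>H \<union> \<sigma> ` H. v r * v s * K r s) = (\<Sum>r\<in>H. \<Sum>s\<in>H. Q v r s)" for v
    unfolding sum_mirror[OF fin inj_mirror disj] sum.distrib[symmetric] Q_def
    by (intro sum.cong refl) (simp add: K1 K2 invol algebra_simps)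
  define D where "D = (\<lambda>(v :: 'a \<Rightarrow> real) r s. v r * v s + v (\<sigma> r) * v (\<sigma> s))"
  \<comment> \<open>The second summand involves only the sums over mirror pairs, which polarization
    preserves. Any change therefore comes from \<open>D\<close>, weighted by the gap
    \<open>K r s - K r (\<sigma> s)\<close>.\<close>
  have Q: "Q v r s = D v r s * (K r s - K r (\<sigma> s)) + (v r + v (\<sigma> r)) * (v s + v (\<sigma> s)) * K r (\<sigma> s)"
    for v r s by (simp add: Q_def D_def algebra_simps)
  have same: "P r + P (\<sigma> r) = u r + u (\<sigma> r)" if "r \<in> H" for r
    using that by (simp add: P_def polarize_near polarize_far)
  have QD: "Q P r s - Q u r s = (D P r s - D u r s) * (K r s - K r (\<sigma> s))"
    if "r \<in> H" "s \<in> H" for r s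
    using that by (simp add: Q same algebra_simps)
  have le: "Q u r s \<le> Q P r s" if rs: "r \<in> H" "s \<in> H" for r s
  proof (cases "r = s")
    case True
    \<comment> \<open>On the diagonal the sign of the gap is unknown, but \<open>D\<close> is a sum
      of two squares there, which a swap leaves unchanged.\<close>
    have "D P r s = D u r s"
      using True rs by (auto simp: D_def P_def polarize_near polarize_far max_def min_def)
    then show ?thesis using QD[OF rs] by simp
  next
    case False
    have "D u r s \<le> D P r s"
      using rs max_min_rearrangement(1) by (simp add: D_def P_def polarize_near polarize_far)
    then have "0 \<le> (D P r s - D u r s) * (K r s - K r (\<sigma> s))"
      using gt[OF rs False] by (intro mult_nonneg_nonneg) auto
    then show ?thesis using QD[OF rs] by simp
  qed
  have less: "Q u x y < Q P x y"
  proof -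
    have "D u x y < D P x y"
      using x y max_min_rearrangement(2) by (simp add: D_def P_def polarize_near polarize_far)
    moreover have "x \<noteq> y" using x y by auto
    ultimately have "0 < (D P x y - D u x y) * (K x y - K x (\<sigma> y))"
      using gt[OF x(1) y(1)] by (intro mult_pos_pos) auto
    then show ?thesis using QD[OF x(1) y(1)] by simp
  qed
  have "(\<Sum>s\<in>H. Q u x s) < (\<Sum>s\<in>H. Q P x s)"
    using less le x y by (intro sum_strict_mono_ex1 fin) auto
  then have "(\<Sum>r\<in>H. \<Sum>s\<in>H. Q u r s) < (\<Sum>r\<in>H. \<Sum>s\<in>H. Q P r s)"
    using le x by (intro sum_strict_mono_ex1 fin) (auto intro!: sum_mono)
  then show ?thesis unfolding form P_def .
qed

end

section \<open>The kernel and positivity of the optimizer\<close>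

definition hls_kernel :: "int ^ 'n \<Rightarrow> int ^ 'n \<Rightarrow> real" where
  "hls_kernel r s = 1 / enorm (r - s) ^ CARD('n)"

lemma enorm_eq_sqrt: "enorm x = sqrt (\<Sum>j\<in>UNIV. (real_of_int (x $ j))\<^sup>2)"
  by (simp add: enorm_def norm_vec_def L2_set_def)

lemma enorm_pos: "x \<noteq> 0 \<Longrightarrow> 0 < enorm x"
  by (simp add: enorm_def vec_eq_iff)

text \<open>No diagonal terms have to be excluded here, since \<open>hls_kernel r r = 1 / 0 = 0\<close>.\<close>

lemma hls_form_kernel:
  fixes S :: "(int ^ 'n) set"
  assumes "finite S"
  shows "hls_form S u v = (\<Sum>r\<in>S. \<Sum>s\<in>S. u r * v s * hls_kernel r s)"
  unfolding hls_form_def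
proof (rule sum.cong[OF refl])
  fix r :: "int ^ 'n"
  have "hls_kernel r r = 0" by (simp add: hls_kernel_def enorm_eq_sqrt)
  then show "(\<Sum>s\<in>S - {r}. u r * v s / enorm (r - s) ^ CARD('n)) = (\<Sum>s\<in>S. u r * v s * hls_kernel r s)"
    by (intro sum.mono_neutral_cong_left) (auto simp: assms hls_kernel_def)
qed

lemma hls_kernel_nonneg: "0 \<le> hls_kernel r s"
  by (simp add: hls_kernel_def enorm_def)

lemma hls_kernel_pos: "r \<noteq> s \<Longrightarrow> 0 < hls_kernel r s"
  by (simp add: hls_kernel_def enorm_pos)

lemma finite_int_cube: "finite (int_cube N :: (int ^ 'n) set)"
proof (rule finite_imageD)
  show "finite (vec_nth ` (int_cube N :: (int ^ 'n) set))"
    by (rule finite_subset[OF _ finite_PiE[of UNIV "\<lambda>_. {- int N..int N}"]])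
      (auto simp: int_cube_def)
  show "inj_on vec_nth (int_cube N :: (int ^ 'n) set)"
    by (simp add: inj_on_def vec_nth_inject)
qed

lemma hls_optimizer_pos:
  fixes S :: "(int ^ 'n) set"
  assumes S: "finite S" and nonneg: "\<And>s. s \<in> S \<Longrightarrow> 0 \<le> a s" and norm: "L2_set a S = 1"
    and opt: "hls_form S a a = hls_max S" and r: "r \<in> S"
  shows "0 < a r"
proof (rule ccontr)
  assume "\<not> 0 < a r"
  with nonneg[OF r] have ar: "a r = 0" by simp
  have sq: "(\<Sum>s\<in>S. (a s)\<^sup>2) = 1" using norm by (simp add: L2_set_def)
  define c where "c = (\<Sum>s\<in>S. a s * hls_kernel s r)"
  define l where "l = hls_max S"
  obtain s where s: "s \<in> S" "a s \<noteq> 0"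
    using sq by (metis (no_types, lifting) power_zero_numeral sum.neutral zero_neq_one)
  then have "0 < a s * hls_kernel s r"
    using nonneg[of s] ar by (intro mult_pos_pos hls_kernel_pos) auto
  then have c: "0 < c"
    unfolding c_def using s S nonneg hls_kernel_nonneg by (intro sum_pos2[of S s]) (auto intro: mult_nonneg_nonneg)
  have l: "0 \<le> l"
    unfolding l_def opt[symmetric] hls_form_kernel[OF S]
    using nonneg hls_kernel_nonneg by (intro sum_nonneg mult_nonneg_nonneg) auto
  \<comment> \<open>Add \<open>t\<close> at the entry \<open>r\<close> of the second argument only:
    the form is then exactly affine in \<open>t\<close>, and the norm becomes
    \<open>sqrt (1 + t\<^sup>2)\<close> because \<open>a r = 0\<close>. The maximum over independent
    pairs admits this competitor.\<close>
  have var: "l + t * c \<le> l * sqrt (1 + t\<^sup>2)" for t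
  proof -
    define w where "w = sqrt (1 + t\<^sup>2)"
    have w: "0 < w" "w\<^sup>2 = 1 + t\<^sup>2" by (auto simp: w_def add_pos_nonneg)
    define b where "b = (\<lambda>s. a s + (if s = r then t else 0))"
    have "(\<Sum>s\<in>S. (b s)\<^sup>2) = (\<Sum>s\<in>S. (a s)\<^sup>2 + (if s = r then t\<^sup>2 else 0))"
      using ar by (intro sum.cong) (auto simp: b_def)
    also have "\<dots> = w\<^sup>2" using S r by (simp add: sum.distrib sq w)
    finally have "L2_set (\<lambda>s. b s / w) S = 1"
      using w(1) by (simp add: L2_set_def power_divide flip: sum_divide_distrib)
    then have "hls_form S a (\<lambda>s. b s / w) \<le> l"
      unfolding l_def using S r norm by (intro hls_max_attained(2)) auto
    moreover have "hls_form S a (\<lambda>s. b s / w) = hls_form S a b / w"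
      unfolding hls_form_def sum_divide_distrib by (simp add: mult.commute)
    moreover have "hls_form S a b = l + t * c"
    proof -
      have "hls_form S a b = (\<Sum>q\<in>S. (\<Sum>s\<in>S. a q * a s * hls_kernel q s)
          + (\<Sum>s\<in>S. if s = r then a q * t * hls_kernel q r else 0))"
        unfolding hls_form_kernel[OF S] sum.distrib[symmetric] b_def
        by (intro sum.cong) (auto simp: algebra_simps)
      also have "\<dots> = hls_form S a a + t * c"
        using S r by (simp add: hls_form_kernel[OF S] sum.distrib c_def sum_distrib_left mult_ac)
      finally show ?thesis using opt l_def by simp
    qed
    ultimately show ?thesis using w(1) by (simp add: w_def[symmetric] field_simps)
  qed
  have "0 < l" using l var[of 1] c by (cases "l = 0") auto
  \<comment> \<open>The choice \<open>t = c / l\<close> maximizes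
    \<open>(l + t * c) / sqrt (1 + t\<^sup>2)\<close>, by Cauchy-Schwarz for \<open>(l, c)\<close>
    and \<open>(1, t)\<close>.\<close>
  moreover have "(l + c / l * c)\<^sup>2 \<le> (l * sqrt (1 + (c / l)\<^sup>2))\<^sup>2"
    using var[of "c / l"] l c by (intro power_mono) auto
  moreover have "(l + c / l * c)\<^sup>2 = l\<^sup>2 + 2 * c\<^sup>2 + (c\<^sup>2 / l)\<^sup>2"
    using \<open>0 < l\<close> by (simp add: power2_sum) (simp add: power2_eq_square)
  moreover have "(l * sqrt (1 + (c / l)\<^sup>2))\<^sup>2 = l\<^sup>2 + c\<^sup>2"
    using \<open>0 < l\<close> by (simp add: power_mult_distrib power_divide distrib_left)
  moreover have "0 < c\<^sup>2" "0 \<le> (c\<^sup>2 / l)\<^sup>2" using c by auto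
  ultimately show False by linarith
qed

section \<open>Reflections of one coordinate and the effect on the kernel\<close>

definition mirror :: "int \<Rightarrow> 'n \<Rightarrow> int ^ 'n \<Rightarrow> int ^ 'n" where
  "mirror m i x = set_coord x i (m - x $ i)"

lemma mirror_nth: "mirror m i x $ j = (if j = i then m - x $ i else x $ j)"
  by (simp add: mirror_def set_coord_def)

lemma mirror_mirror: "mirror m i (mirror m i x) = x"
  by (simp add: vec_eq_iff mirror_nth)

lemma hls_kernel_mirror:
  "hls_kernel (mirror m i x) (mirror m i y) = hls_kernel x y"
  "hls_kernel (mirror m i x) y = hls_kernel x (mirror m i y)"
proof -
  have "(real_of_int ((mirror m i x - mirror m i y) $ j))\<^sup>2 = (real_of_int ((x - y) $ j))\<^sup>2"
    and "(real_of_int ((mirror m i x - y) $ j))\<^sup>2 = (real_of_int ((x - mirror m i y) $ j))\<^sup>2" for j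
    by (auto simp: mirror_nth power2_eq_square algebra_simps)
  then show "hls_kernel (mirror m i x) (mirror m i y) = hls_kernel x y"
    and "hls_kernel (mirror m i x) y = hls_kernel x (mirror m i y)"
    by (simp_all add: hls_kernel_def enorm_eq_sqrt)
qed

text \<open>The difference of the squares is \<open>m * (m - 2 * x)\<close>. Thus for all points on
  the near side \<open>m - 2 * x\<close> has the sign of \<open>m\<close>.\<close>

lemma closer_iff: "\<bar>x\<bar> < \<bar>m - x\<bar> \<longleftrightarrow> 0 < m * (m - 2 * x)" for x m :: int
proof -
  have "\<bar>x\<bar> < \<bar>m - x\<bar> \<longleftrightarrow> x\<^sup>2 < (m - x)\<^sup>2" using linorder_not_le abs_le_square_iff by metis
  then show ?thesis by (simp add: power2_eq_square algebra_simps)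
qed

lemma hls_kernel_mirror_less:
  assumes "\<bar>x $ i\<bar> < \<bar>m - x $ i\<bar>" "\<bar>y $ i\<bar> < \<bar>m - y $ i\<bar>" "x \<noteq> y"
  shows "hls_kernel x (mirror m i y) < hls_kernel x y"
proof -
  have prod: "0 < (m - 2 * x $ i) * (m - 2 * y $ i)"
    using assms(1,2) unfolding closer_iff by (auto simp: zero_less_mult_iff)
  have at: "(x $ i - y $ i)\<^sup>2 < (x $ i - (m - y $ i))\<^sup>2"
    using prod by (simp add: power2_eq_square algebra_simps)
  have "(real_of_int ((x - y) $ i))\<^sup>2 < (real_of_int ((x - mirror m i y) $ i))\<^sup>2"
    using at unfolding of_int_power[symmetric] of_int_less_iff by (simp add: mirror_nth)
  moreover have "(real_of_int ((x - y) $ j))\<^sup>2 = (real_of_int ((x - mirror m i y) $ j))\<^sup>2" if "j \<noteq> i" for j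
    using that by (simp add: mirror_nth)
  ultimately have "enorm (x - y) < enorm (x - mirror m i y)"
    unfolding enorm_eq_sqrt real_sqrt_less_iff
    by (intro sum_strict_mono_ex1) (auto, metis less_eq_real_def)
  moreover have "0 < enorm (x - y)" using assms(3) by (simp add: enorm_pos)
  ultimately show ?thesis
    unfolding hls_kernel_def
    by (intro divide_strict_left_mono power_strict_mono mult_pos_pos zero_less_power) auto
qed

section \<open>Polarizing the optimizer on the cube\<close>

lemma hls_optimizer_mirror_le:
  fixes S :: "(int ^ 'n) set"
  assumes S_def: "S = int_cube N" and nonneg: "\<And>s. s \<in> S \<Longrightarrow> 0 \<le> a s" and norm: "L2_set a S = 1"
    and opt: "hls_form S a a = hls_max S" and m: "odd m"
    and x: "x \<in> S" "\<bar>x $ i\<bar> < \<bar>m - x $ i\<bar>" and x': "mirror m i x \<in> S"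
  shows "a (mirror m i x) \<le> a x"
proof (rule ccontr)
  assume wrong: "\<not> a (mirror m i x) \<le> a x"
  have S: "finite S" unfolding S_def by (rule finite_int_cube)
  define \<sigma> where "\<sigma> = mirror m i"
  \<comment> \<open>The mirror image of the cube is a shifted box, so \<open>a\<close> is extended
    by zero to the symmetric set \<open>T\<close>.\<close>
  define A where "A = (\<lambda>z. if z \<in> S then a z else 0)"
  define T where "T = S \<union> \<sigma> ` S"
  define H where "H = {z \<in> T. \<bar>z $ i\<bar> < \<bar>m - z $ i\<bar>}"
  define P where "P = polarize H \<sigma> A"
  have invol: "\<sigma> (\<sigma> z) = z" for z by (simp add: \<sigma>_def mirror_mirror)
  have T: "finite T" using S by (simp add: T_def)
  have H: "finite H" using T by (simp add: H_def)
  have \<sigma>T: "\<sigma> z \<in> T" if "z \<in> T" for z using that invol by (auto simp: T_def)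
  have disj: "H \<inter> \<sigma> ` H = {}" by (auto simp: H_def \<sigma>_def mirror_nth)
  have far: "\<sigma> z \<in> H" if "z \<in> T" "z \<notin> H" for z
  proof -
    \<comment> \<open>Oddness of \<open>m\<close> excludes both fixed points and ties in distance,
      so exactly one point of each mirror pair lies in \<open>H\<close>.\<close>
    have "m - z $ i \<noteq> z $ i" "m - z $ i \<noteq> - z $ i" using m by presburger+
    then have "\<bar>m - z $ i\<bar> < \<bar>z $ i\<bar>" using that by (auto simp: H_def)
    then show ?thesis using \<sigma>T[OF that(1)] by (simp add: H_def \<sigma>_def mirror_nth)
  qed
  have TH: "T = H \<union> \<sigma> ` H"
  proof
    show "T \<subseteq> H \<union> \<sigma> ` H" using far invol by (metis Un_iff imageI subsetI)
    show "H \<union> \<sigma> ` H \<subseteq> T" using \<sigma>T by (auto simp: H_def)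
  qed
  \<comment> \<open>If the farther point of a pair lies in the cube, so does the nearer one.\<close>
  have HS: "H \<subseteq> S"
  proof
    fix z assume z: "z \<in> H"
    show "z \<in> S"
    proof (rule ccontr)
      assume "z \<notin> S"
      then have z': "\<sigma> z \<in> S" using z invol by (auto simp: H_def T_def)
      have "- int N \<le> z $ j \<and> z $ j \<le> int N" for j
      proof (cases "j = i")
        case True
        have "- int N \<le> \<sigma> z $ i" "\<sigma> z $ i \<le> int N" using z' by (auto simp: S_def int_cube_def)
        then show ?thesis using True z by (auto simp: H_def \<sigma>_def mirror_nth)
      next
        case False
        have "- int N \<le> \<sigma> z $ j" "\<sigma> z $ j \<le> int N" using z' by (auto simp: S_def int_cube_def)
        then show ?thesis using False by (simp add: \<sigma>_def mirror_nth)
      qed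
      then show False using \<open>z \<notin> S\<close> by (simp add: S_def int_cube_def)
    qed
  qed
  have A0: "0 \<le> A z" for z using nonneg by (simp add: A_def)
  \<comment> \<open>Points outside the cube are not in \<open>H\<close>, hence receive the minimum
    of zero and a nonnegative value.\<close>
  have P0: "P z = 0" if "z \<notin> S" for z
    using that HS A0[of "\<sigma> z"] by (auto simp: P_def polarize_def A_def min_def)
  have formT: "(\<Sum>r\<in>T. \<Sum>s\<in>T. v r * v s * hls_kernel r s) = hls_form S v v"
    if "\<And>z. z \<notin> S \<Longrightarrow> v z = 0" for v
    unfolding hls_form_kernel[OF S] using that T
    by (intro sum.mono_neutral_cong_right) (auto simp: T_def intro!: sum.mono_neutral_right)
  have normT: "(\<Sum>r\<in>T. (v r)\<^sup>2) = (\<Sum>r\<in>S. (v r)\<^sup>2)" if "\<And>z. z \<notin> S \<Longrightarrow> v z = 0" for v :: "int ^ 'n \<Rightarrow> real"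
    using that T by (intro sum.mono_neutral_right) (auto simp: T_def)
  \<comment> \<open>This \<open>y\<close> lies on the face of the cube on the near side; its mirror
    image has \<open>i\<close>-th coordinate of absolute value \<open>int N + \<bar>m\<bar>\<close>
    and so leaves the cube. Positivity of \<open>a y\<close> makes this pair strictly
    ordered.\<close>
  define y where "y = set_coord x i (- sgn m * int N)"
  have "m \<noteq> 0" using m by auto
  then have yi: "\<bar>y $ i\<bar> = int N" "\<bar>m - y $ i\<bar> = int N + \<bar>m\<bar>"
    by (auto simp: y_def set_coord_def sgn_if)
  have yS: "y \<in> S" using x(1) by (auto simp: y_def S_def int_cube_def set_coord_def sgn_if)
  have yH: "y \<in> H" using yS yi \<open>m \<noteq> 0\<close> by (simp add: H_def T_def)
  have "\<bar>\<sigma> y $ i\<bar> > int N" using yi \<open>m \<noteq> 0\<close> by (simp add: \<sigma>_def mirror_nth)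
  then have "\<sigma> y \<notin> S" by (auto simp: S_def int_cube_def abs_le_iff not_le intro!: exI[of _ i])
  then have y: "A (\<sigma> y) < A y"
    using hls_optimizer_pos[OF S nonneg norm opt yS] yS by (simp add: A_def)
  have xH: "x \<in> H" using x by (simp add: H_def T_def)
  have xA: "A x < A (\<sigma> x)" using wrong x(1) x' by (simp add: A_def \<sigma>_def)
  have "hls_form S A A < hls_form S P P"
  proof -
    have "(\<Sum>r\<in>H \<union> \<sigma> ` H. \<Sum>s\<in>H \<union> \<sigma> ` H. A r * A s * hls_kernel r s)
      < (\<Sum>r\<in>H \<union> \<sigma> ` H. \<Sum>s\<in>H \<union> \<sigma> ` H. polarize H \<sigma> A r * polarize H \<sigma> A s * hls_kernel r s)"
      using H invol disj _ _ _ xH xA yH y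
    proof (rule polarize_less)
      show "hls_kernel (\<sigma> r) (\<sigma> s) = hls_kernel r s"
        "hls_kernel (\<sigma> r) s = hls_kernel r (\<sigma> s)" for r s
        by (simp_all add: \<sigma>_def hls_kernel_mirror mirror_mirror)
      show "hls_kernel r (\<sigma> s) < hls_kernel r s" if "r \<in> H" "s \<in> H" "r \<noteq> s" for r s
        unfolding \<sigma>_def using that by (intro hls_kernel_mirror_less) (auto simp: H_def)
    qed
    then show ?thesis
      unfolding TH[symmetric] P_def[symmetric] using formT[of A] formT[of P] P0 by (simp add: A_def)
  qed
  moreover have "hls_form S A A = hls_form S a a"
    unfolding hls_form_kernel[OF S] by (intro sum.cong) (auto simp: A_def)
  moreover have "L2_set P S = 1"
  proof -
    have "(\<Sum>r\<in>S. (P r)\<^sup>2) = (\<Sum>r\<in>S. (A r)\<^sup>2)"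
      using sum_polarize[OF H invol disj, of "\<lambda>t. t\<^sup>2" A] normT[of P] normT[of A] P0
      unfolding TH[symmetric] P_def[symmetric] by (simp add: A_def)
    also have "\<dots> = (\<Sum>r\<in>S. (a r)\<^sup>2)" by (simp add: A_def)
    finally show ?thesis using norm by (simp add: L2_set_def)
  qed
  then have "hls_form S P P \<le> hls_max S"
    using S x(1) by (intro hls_max_attained(2)) auto
  ultimately show False using opt by simp
qed

theorem theorem4:
  fixes N :: nat and S :: "(int ^ 'n) set" and a :: "int ^ 'n \<Rightarrow> real"
  assumes "N \<ge> 1"
    and "S = int_cube N"
    and "\<forall>r\<in>S. 0 \<le> a r"
    and "L2_set a S = 1"
    and "hls_form S a a = hls_max S"
  shows "(\<forall>r\<in>S. 0 < a r) \<and>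
    (\<forall>i. \<forall>r'\<in>S.
      (\<forall>k. 1 \<le> k \<and> k \<le> int N \<longrightarrow> a (set_coord r' i k) \<le> a (set_coord r' i (k - 1))) \<and>
      (\<forall>k. - int N + 1 \<le> k \<and> k \<le> 0 \<longrightarrow> a (set_coord r' i k) \<ge> a (set_coord r' i (k - 1))))"
proof -
  have S: "finite S" using assms(2) finite_int_cube by simp
  \<comment> \<open>The reflection with \<open>m = k + l\<close> exchanges the values
    \<open>k\<close> and \<open>l\<close> of coordinate \<open>i\<close>. Neighbouring integers have
    odd sum, so both halves of the claim are instances.\<close>
  have mono: "a (set_coord r i k) \<le> a (set_coord r i l)"
    if r: "r \<in> S" and kl: "\<bar>l\<bar> < \<bar>k\<bar>" "odd (k + l)" "\<bar>k\<bar> \<le> int N" for r i k l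
  proof -
    define x where "x = set_coord r i l"
    have mx: "mirror (k + l) i x = set_coord r i k"
      by (simp add: vec_eq_iff mirror_nth x_def set_coord_def)
    have "a (mirror (k + l) i x) \<le> a x"
    proof (rule hls_optimizer_mirror_le[OF assms(2)])
      show "x \<in> S" "mirror (k + l) i x \<in> S"
        unfolding mx unfolding x_def using r kl assms(2) by (auto simp: int_cube_def set_coord_def)
      show "\<bar>x $ i\<bar> < \<bar>k + l - x $ i\<bar>" using kl by (simp add: x_def set_coord_def)
    qed (use assms kl in auto)
    then show ?thesis unfolding mx by (simp add: x_def)
  qed
  have "0 < a r" if "r \<in> S" for r
    using hls_optimizer_pos[OF S _ assms(4,5) that] assms(3) by blast
  moreover have "a (set_coord r i k) \<le> a (set_coord r i (k - 1))"
    if "r \<in> S" "1 \<le> k" "k \<le> int N" for r i k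
    using that by (intro mono) auto
  moreover have "a (set_coord r i (k - 1)) \<le> a (set_coord r i k)"
    if "r \<in> S" "- int N + 1 \<le> k" "k \<le> 0" for r i k
    using that by (intro mono) auto
  ultimately show ?thesis by blast
qed

end
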